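(* Let $U,V\subseteq\mathbb{R}^n$ be linear subspaces with $V\not\subset U$. The following are equivalent: (a) $\theta_F=\theta_p$; (b) $\rho_V=0$; (c) $C_T$ started from $V$ converges in one step: $C_T(P_Vx_0)=P_{U\cap V}(x_0)$ for every $x_0\in\mathbb{R}^n$; (d) the restriction of $M$ to $V\cap(U\cap V)^\perp$ is a positive scalar multiple of the identity. A sufficient (but not necessary) geometric condition for these is $\dim V-\dim(U\cap V)=1$.
   Context: For a linear subspace $W\subseteq\mathbb{R}^n$, $P_W$ is the orthogonal projection onto $W$ and $R_W=2P_W-\mathrm{Id}$. $p=\dim V$, $s=\dim(U\cap V)<p$. Principal angles: let $\sigma_1\ge\dots\ge\sigma_p\ge0$ be the singular values of $P_U|_V:V\to\mathbb{R}^n$ and $\theta_k=\arccos\sigma_k$, so $0\le\theta_1\le\dots\le\theta_p\le\pi/2$; the first $s$ are $0$. The Friedrichs angle is $\theta_F:=\theta_{s+1}\in(0,\pi/2]$, and $$\rho_V:=\frac{\sin^2\theta_p-\sin^2\theta_F}{\sin^2\theta_p+\sin^2\theta_F}.$$ $M:=(\mathrm{Id}-P_VP_U)|_V:V\to V$. Circumcenter: for a finite set $S\subset\mathbb{R}^n$ for which some point $q\in\mathbb{R}^n$ is equidistant from all elements of $S$, $\mathrm{circumcenter}(S):=P_{\mathrm{aff}(S)}(q)$, the orthogonal projection of $q$ onto the affine hull of $S$ (independent of the choice of $q$). $C_T(x):=\mathrm{circumcenter}\{x,R_Ux,R_VR_Ux\}$ (any point of $U\cap V$ is equidistant from the three vertices).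 *)

theory Defs
  imports "HOL-Analysis.Analysis"
begin

text \<open>Stated for affine sets, since the circumcenter projects onto an affine hull. For a linear
  subspace the condition says that \<open>x - y\<close> is orthogonal to \<open>S\<close>.\<close>

definition orth_proj :: "'a::euclidean_space set \<Rightarrow> 'a \<Rightarrow> 'a" where
  "orth_proj S x = (THE y. y \<in> S \<and> (\<forall>z\<in>S. orthogonal (x - y) (z - y)))"

definition reflect :: "'a::euclidean_space set \<Rightarrow> 'a \<Rightarrow> 'a" where
  "reflect W x = 2 *\<^sub>R orth_proj W x - x"

lemma orth_proj_unique:
  assumes "y \<in> S" "\<And>z. z \<in> S \<Longrightarrow> orthogonal (x - y) (z - y)"
  shows "orth_proj S x = y"
  unfolding orth_proj_def
proof (rule the_equality)
  show "y \<in> S \<and> (\<forall>z\<in>S. orthogonal (x - y) (z - y))"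
    using assms by blast
next
  fix y' assume y': "y' \<in> S \<and> (\<forall>z\<in>S. orthogonal (x - y') (z - y'))"
  have "inner (x - y) (y' - y) = 0" "inner (x - y') (y - y') = 0"
    using assms y' by (auto simp: orthogonal_def)
  then have "inner (y' - y) (y' - y) = 0"
    by (simp add: inner_diff_left inner_diff_right inner_commute)
  then show "y' = y" by simp
qed

lemma closest_point_orthogonal:
  fixes S :: "'a::euclidean_space set"
  assumes "affine S" "S \<noteq> {}" "z \<in> S"
  shows "orthogonal (x - closest_point S x) (z - closest_point S x)"
proof -
  let ?y = "closest_point S x"
  have cl: "closed S" and cv: "convex S"
    using assms by (simp_all add: affine_closed affine_imp_convex)
  have yS: "?y \<in> S" using closest_point_in_set[OF cl assms(2)] .
  have le: "inner (x - ?y) (w - ?y) \<le> 0" if "w \<in> S" for w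
    using closest_point_dot[OF cv cl that] .
  have "2 *\<^sub>R ?y + (-1) *\<^sub>R z \<in> S"
    using mem_affine[OF assms(1) yS assms(3), of 2 "-1"] by simp
  from le[OF this] have "inner (x - ?y) (?y - z) \<le> 0"
    by (simp add: scaleR_2)
  with le[OF assms(3)] show ?thesis
    by (simp add: orthogonal_def inner_diff_right)
qed

lemma orth_proj_eq_closest_point:
  fixes S :: "'a::euclidean_space set"
  assumes "affine S" "S \<noteq> {}"
  shows "orth_proj S x = closest_point S x"
  using assms closest_point_orthogonal
  by (intro orth_proj_unique) (auto simp: affine_closed closest_point_in_set)

lemma orth_proj_in_orthogonal:
  fixes W :: "'a::euclidean_space set"
  assumes "subspace W"
  shows "orth_proj W x \<in> W" and "w \<in> W \<Longrightarrow> inner (x - orth_proj W x) w = 0"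
proof -
  have W: "affine W" "W \<noteq> {}"
    using subspace_imp_affine[OF assms] subspace_0[OF assms] by auto
  show in_W: "orth_proj W x \<in> W"
    using W by (simp add: orth_proj_eq_closest_point affine_closed closest_point_in_set)
  show "inner (x - orth_proj W x) w = 0" if "w \<in> W"
  proof -
    have "w + orth_proj W x \<in> W"
      using assms in_W that by (simp add: subspace_add)
    from closest_point_orthogonal[OF W this, of x] show ?thesis
      by (simp add: orth_proj_eq_closest_point W orthogonal_def)
  qed
qed

lemma linear_orth_proj:
  fixes W :: "'a::euclidean_space set"
  assumes "subspace W"
  shows "linear (orth_proj W)"
proof -
  note P = orth_proj_in_orthogonal[OF assms]
  have *: "orth_proj W x = y" if "y \<in> W" "\<And>w. w \<in> W \<Longrightarrow> inner (x - y) w = 0" for x y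
    using that assms by (intro orth_proj_unique) (auto simp: orthogonal_def subspace_diff)
  show ?thesis
  proof (rule linearI)
    fix x y show "orth_proj W (x + y) = orth_proj W x + orth_proj W y"
    proof (rule *)
      fix w assume "w \<in> W"
      then show "inner (x + y - (orth_proj W x + orth_proj W y)) w = 0"
        using P(2)[of w x] P(2)[of w y] by (simp add: inner_diff_left inner_add_left)
    qed (simp add: P(1) assms subspace_add)
  next
    fix c x show "orth_proj W (c *\<^sub>R x) = c *\<^sub>R orth_proj W x"
    proof (rule *)
      fix w assume "w \<in> W"
      then show "inner (c *\<^sub>R x - c *\<^sub>R orth_proj W x) w = 0"
        using P(2)[of w x] by (simp add: inner_diff_left)
    qed (simp add: P(1) assms subspace_scale)
  qed
qed

text \<open>For linear \<open>f\<close> and a subspace \<open>V\<close>, this is the adjoint of the restriction of \<open>f\<close> to \<open>V\<close>,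
  a map from the codomain of \<open>f\<close> to \<open>V\<close> (see \<open>restr_adjoint_works\<close>).\<close>

definition restr_adjoint ::
    "'a::euclidean_space set \<Rightarrow> ('a \<Rightarrow> 'b::euclidean_space) \<Rightarrow> 'b \<Rightarrow> 'a" where
  "restr_adjoint V f y = orth_proj V (adjoint f y)"

lemma restr_adjoint_works:
  fixes f :: "'a::euclidean_space \<Rightarrow> 'b::euclidean_space"
  assumes "subspace V" "linear f"
  shows "restr_adjoint V f y \<in> V"
    and "v \<in> V \<Longrightarrow> inner (f v) y = inner v (restr_adjoint V f y)"
proof -
  show "restr_adjoint V f y \<in> V"
    by (simp add: restr_adjoint_def orth_proj_in_orthogonal assms)
  show "inner (f v) y = inner v (restr_adjoint V f y)" if "v \<in> V"
    using orth_proj_in_orthogonal(2)[OF assms(1) that, of "adjoint f y"]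
      adjoint_works[OF assms(2), of v y]
    by (simp add: restr_adjoint_def inner_diff_left inner_commute[of v])
qed

text \<open>The eigenspace, inside \<open>V\<close>, of \<open>A\<^sup>*A\<close> for the eigenvalue \<open>\<sigma>\<^sup>2\<close>, where \<open>A\<close> is the
  restriction of \<open>f\<close> to \<open>V\<close>.\<close>

definition singular_space ::
    "'a::euclidean_space set \<Rightarrow> ('a \<Rightarrow> 'b::euclidean_space) \<Rightarrow> real \<Rightarrow> 'a set" where
  "singular_space V f \<sigma> = {v \<in> V. restr_adjoint V f (f v) = \<sigma>\<^sup>2 *\<^sub>R v}"

text \<open>The singular values of the restriction of \<open>f\<close> to \<open>V\<close>, i.e. the nonnegative square roots of
  the eigenvalues of \<open>A\<^sup>*A\<close>, in decreasing order and repeated according to multiplicity. The set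
  of distinct values being listed is finite by \<open>finite_singular_values\<close>.\<close>

definition singular_values ::
    "'a::euclidean_space set \<Rightarrow> ('a \<Rightarrow> 'b::euclidean_space) \<Rightarrow> real list" where
  "singular_values V f =
     concat (map (\<lambda>\<sigma>. replicate (dim (singular_space V f \<sigma>)) \<sigma>)
       (rev (sorted_list_of_set {\<sigma>. 0 \<le> \<sigma> \<and> (\<exists>v\<in>singular_space V f \<sigma>. v \<noteq> 0)})))"

lemma finite_singular_values:
  fixes f :: "'a::euclidean_space \<Rightarrow> 'b::euclidean_space"
  assumes V: "subspace V" and f: "linear f"
  shows "finite {\<sigma>. 0 \<le> \<sigma> \<and> (\<exists>v\<in>singular_space V f \<sigma>. v \<noteq> 0)}" (is "finite ?S")
proof -
  have "\<forall>\<sigma>\<in>?S. \<exists>v. v \<in> singular_space V f \<sigma> \<and> v \<noteq> 0" by blast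
  then obtain g where "\<forall>\<sigma>\<in>?S. g \<sigma> \<in> singular_space V f \<sigma> \<and> g \<sigma> \<noteq> 0"
    by (rule bchoice[THEN exE])
  then have g: "\<And>\<sigma>. \<sigma> \<in> ?S \<Longrightarrow> g \<sigma> \<in> singular_space V f \<sigma> \<and> g \<sigma> \<noteq> 0" by (rule bspec)
  have orth: "inner (g \<sigma>) (g \<tau>) = 0" if "\<sigma> \<in> ?S" "\<tau> \<in> ?S" "\<sigma> \<noteq> \<tau>" for \<sigma> \<tau>
  proof -
    have *: "inner (f (g \<tau>)) (f (g \<sigma>)) = \<sigma>\<^sup>2 * inner (g \<tau>) (g \<sigma>)"
      "inner (f (g \<sigma>)) (f (g \<tau>)) = \<tau>\<^sup>2 * inner (g \<sigma>) (g \<tau>)"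
      using g[OF that(1)] g[OF that(2)] by (auto simp: singular_space_def restr_adjoint_works[OF V f])
    then have "\<sigma>\<^sup>2 * inner (g \<sigma>) (g \<tau>) = \<tau>\<^sup>2 * inner (g \<sigma>) (g \<tau>)"
      by (metis inner_commute)
    moreover have "\<sigma>\<^sup>2 \<noteq> \<tau>\<^sup>2" using that by (auto simp: power2_eq_iff)
    ultimately show ?thesis by simp
  qed
  have inj: "inj_on g ?S"
  proof (rule inj_onI, rule ccontr)
    fix \<sigma> \<tau> assume *: "\<sigma> \<in> ?S" "\<tau> \<in> ?S" "g \<sigma> = g \<tau>" "\<sigma> \<noteq> \<tau>"
    from orth[OF *(1,2,4)] *(3) g[OF *(2)] show False by simp
  qed
  have "pairwise orthogonal (g ` ?S)"
  proof (rule pairwiseI)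
    fix x y assume "x \<in> g ` ?S" "y \<in> g ` ?S" "x \<noteq> y"
    then obtain \<sigma> \<tau> where *: "\<sigma> \<in> ?S" "\<tau> \<in> ?S" "x = g \<sigma>" "y = g \<tau>" "\<sigma> \<noteq> \<tau>" by blast
    then show "orthogonal x y" using orth[OF *(1,2,5)] by (simp add: orthogonal_def)
  qed
  then have "finite (g ` ?S)" by (rule pairwise_orthogonal_imp_finite)
  with inj show ?thesis by (rule finite_imageD[rotated])
qed

text \<open>Indexed from \<open>1\<close> to \<open>dim V\<close>, smallest angle first.\<close>

definition principal_angle :: "'a::euclidean_space set \<Rightarrow> 'a set \<Rightarrow> nat \<Rightarrow> real" where
  "principal_angle U V k = arccos (singular_values V (orth_proj U) ! (k - 1))"

definition friedrichs_angle :: "'a::euclidean_space set \<Rightarrow> 'a set \<Rightarrow> real" where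
  "friedrichs_angle U V = principal_angle U V (dim (U \<inter> V) + 1)"

definition rho :: "'a::euclidean_space set \<Rightarrow> 'a set \<Rightarrow> real" where
  "rho U V =
     ((sin (principal_angle U V (dim V)))\<^sup>2 - (sin (friedrichs_angle U V))\<^sup>2) /
     ((sin (principal_angle U V (dim V)))\<^sup>2 + (sin (friedrichs_angle U V))\<^sup>2)"

text \<open>Meaningful only if some point is equidistant from all elements of \<open>S\<close>.\<close>

definition circumcenter :: "'a::euclidean_space set \<Rightarrow> 'a" where
  "circumcenter S =
     orth_proj (affine hull S) (SOME q. \<forall>x\<in>S. \<forall>y\<in>S. dist q x = dist q y)"

lemma circumcenter_eq:
  fixes S :: "'a::euclidean_space set"
  assumes "S \<noteq> {}" and q: "\<forall>x\<in>S. \<forall>y\<in>S. dist q x = dist q y"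
  shows "circumcenter S = orth_proj (affine hull S) q"
proof -
  define q' where "q' = (SOME q. \<forall>x\<in>S. \<forall>y\<in>S. dist q x = dist q y)"
  have q': "\<forall>x\<in>S. \<forall>y\<in>S. dist q' x = dist q' y"
    unfolding q'_def by (rule someI[where P = "\<lambda>q. \<forall>x\<in>S. \<forall>y\<in>S. dist q x = dist q y", OF q])
  have dist_sq: "(dist c x)\<^sup>2 = inner c c - 2 * inner c x + inner x x" for c x :: 'a
    by (simp add: dist_norm power2_norm_eq_inner inner_diff_left inner_diff_right inner_commute)
  let ?A = "affine hull S"
  let ?p = "orth_proj ?A q"
  have A: "affine ?A" "?A \<noteq> {}" using assms(1) by auto
  have pA: "?p \<in> ?A"
    using A by (simp add: orth_proj_eq_closest_point affine_closed closest_point_in_set)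
  obtain x0 where x0: "x0 \<in> S" using assms(1) by blast
  have "inner (q' - q) x = inner (q' - q) x0" if "x \<in> S" for x
  proof -
    have "(dist q x)\<^sup>2 = (dist q x0)\<^sup>2" "(dist q' x)\<^sup>2 = (dist q' x0)\<^sup>2"
      using q q' that x0 by metis+
    then show ?thesis unfolding dist_sq by (simp add: inner_diff_left)
  qed
  then have "S \<subseteq> {x. inner (q' - q) x = inner (q' - q) x0}" by blast
  then have hull: "?A \<subseteq> {x. inner (q' - q) x = inner (q' - q) x0}"
    by (rule hull_minimal) (simp add: affine_hyperplane)
  have "orth_proj ?A q' = ?p"
  proof (rule orth_proj_unique[OF pA])
    fix z assume z: "z \<in> ?A"
    have "inner (q - ?p) (z - ?p) = 0"
      using closest_point_orthogonal[OF A z, of q] orth_proj_eq_closest_point[OF A, of q]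
      by (simp add: orthogonal_def)
    moreover have "inner (q' - q) (z - ?p) = 0"
      using subsetD[OF hull z] subsetD[OF hull pA] by (simp add: inner_diff_right)
    ultimately show "orthogonal (q' - ?p) (z - ?p)"
      by (simp add: orthogonal_def inner_diff_left)
  qed
  then show ?thesis by (simp add: circumcenter_def q'_def)
qed

definition C_T :: "'a::euclidean_space set \<Rightarrow> 'a set \<Rightarrow> 'a \<Rightarrow> 'a" where
  "C_T U V x = circumcenter {x, reflect U x, reflect V (reflect U x)}"

definition one_step_convergence :: "'a::euclidean_space set \<Rightarrow> 'a set \<Rightarrow> bool" where
  "one_step_convergence U V \<longleftrightarrow>
     (\<forall>x\<^sub>0. C_T U V (orth_proj V x\<^sub>0) = orth_proj (U \<inter> V) x\<^sub>0)"

text \<open>The operator of interest is the restriction of this map to \<open>V\<close>, which maps \<open>V\<close> to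
  itself.\<close>

definition M_op :: "'a::euclidean_space set \<Rightarrow> 'a set \<Rightarrow> 'a \<Rightarrow> 'a" where
  "M_op U V v = v - orth_proj V (orth_proj U v)"

definition M_scalar :: "'a::euclidean_space set \<Rightarrow> 'a set \<Rightarrow> bool" where
  "M_scalar U V \<longleftrightarrow> (\<exists>c>0. \<forall>v \<in> V \<inter> (U \<inter> V)\<^sup>\<bottom>. M_op U V v = c *\<^sub>R v)"

end

theory Submission
  imports Defs
begin

text \<open>Everything is decided on \<open>V \<inter> (U \<inter> V)\<^sup>\<bottom>\<close>, which is nonzero because \<open>V\<close> is not contained
  in \<open>U\<close>.

  The squared singular values of \<open>P\<^sub>U|\<^sub>V\<close> are the eigenvalues on \<open>V\<close> of the symmetric operator
  \<open>P\<^sub>V P\<^sub>U = Id - M\<close>, and the eigenspace for \<open>1\<close> is \<open>U \<inter> V\<close>. By the spectral theorem the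
  eigenspaces span \<open>V\<close>, so the ordered list of singular values has length \<open>dim V\<close> and consists of
  \<open>dim (U \<inter> V)\<close> ones followed by the values less than \<open>1\<close>. Hence \<open>\<theta>\<^sub>F\<close> and \<open>\<theta>\<^sub>p\<close> are the
  arccosines of the largest and the smallest singular value less than \<open>1\<close> (\<open>extreme_angles\<close>).
  They agree iff only one such value occurs; equivalently, \<open>\<rho>\<^sub>V = 0\<close>; equivalently, \<open>M\<close> has a
  single eigenvalue on \<open>V \<inter> (U \<inter> V)\<^sup>\<bottom>\<close> and so is scalar there (\<open>extreme_eq_iff_M_scalar\<close>).

  For the circumcenter, let \<open>x \<in> V\<close> and \<open>w = P x\<close>, with \<open>P\<close> the projection onto \<open>U \<inter> V\<close>. Since
  \<open>w\<close> is equidistant from the three vertices, \<open>C\<^sub>T x = w\<close> iff \<open>w\<close> lies in their affine hull, and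
  this turns out to mean that \<open>x - w\<close> is a multiple of \<open>M x = M (x - w)\<close> (\<open>C_T_eq_proj_iff\<close>). Thus
  one-step convergence says that every vector of \<open>V \<inter> (U \<inter> V)\<^sup>\<bottom>\<close> is an eigenvector of \<open>M\<close> with
  nonzero eigenvalue; a linear map with only eigenvectors is scalar, and \<open>M\<close> is positive
  semidefinite (\<open>one_step_convergence_iff_M_scalar\<close>).

  If \<open>dim V - dim (U \<inter> V) = 1\<close>, the two angles are the same entry of the list. The pair of \<open>{0}\<close>
  and the whole space, where \<open>M\<close> is the identity, shows that the condition is not necessary
  in dimension at least \<open>2\<close>.\<close>

section \<open>Orthogonal projections and the operator \<open>P\<^sub>V P\<^sub>U\<close>\<close>

lemma orth_proj_subspace_eqI:
  assumes "subspace W" "y \<in> W" "\<And>w. w \<in> W \<Longrightarrow> inner (x - y) w = 0"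
  shows "orth_proj W x = y"
  using assms by (intro orth_proj_unique) (auto simp: orthogonal_def subspace_diff)

lemma orth_proj_id:
  assumes "subspace W" "x \<in> W"
  shows "orth_proj W x = x"
  using assms by (intro orth_proj_subspace_eqI) auto

lemma inner_orth_proj_right:
  assumes "subspace W" "w \<in> W"
  shows "inner w (orth_proj W x) = inner w x"
  using orth_proj_in_orthogonal(2)[OF assms, of x] by (simp add: inner_diff_left inner_commute[of w])

lemma inner_orth_proj_symmetric:
  assumes "subspace W"
  shows "inner (orth_proj W x) y = inner x (orth_proj W y)"
  using inner_orth_proj_right[OF assms orth_proj_in_orthogonal(1)[OF assms], of x y]
    inner_orth_proj_right[OF assms orth_proj_in_orthogonal(1)[OF assms], of y x]
  by (simp add: inner_commute)

lemma norm_orth_proj_pythagoras: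
  assumes "subspace W"
  shows "inner x x = inner (orth_proj W x) (orth_proj W x)
           + inner (x - orth_proj W x) (x - orth_proj W x)"
  using orth_proj_in_orthogonal(2)[OF assms orth_proj_in_orthogonal(1)[OF assms], of x x]
  by (simp add: inner_diff_left inner_diff_right inner_commute)

lemma orth_proj_comp_subset:
  assumes "subspace W" "subspace V" "W \<subseteq> V"
  shows "orth_proj W (orth_proj V x) = orth_proj W x"
proof (rule orth_proj_subspace_eqI[OF assms(1)])
  show "orth_proj W x \<in> W" by (rule orth_proj_in_orthogonal[OF assms(1)])
  fix w assume w: "w \<in> W"
  then have "inner (x - orth_proj V x) w = 0" "inner (x - orth_proj W x) w = 0"
    using assms by (auto intro: orth_proj_in_orthogonal)
  then show "inner (orth_proj V x - orth_proj W x) w = 0"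
    by (simp add: inner_diff_left)
qed

text \<open>Since \<open>P\<^sub>U\<close> is symmetric and idempotent, the operator \<open>A\<^sup>*A\<close> belonging to \<open>A = P\<^sub>U|\<^sub>V\<close> is
  \<open>P\<^sub>V P\<^sub>U\<close>; the squared singular values are its eigenvalues on \<open>V\<close>.\<close>

lemma singular_space_orth_proj:
  assumes "subspace U" "subspace V"
  shows "singular_space V (orth_proj U) \<sigma> =
    {v \<in> V. orth_proj V (orth_proj U v) = \<sigma>\<^sup>2 *\<^sub>R v}"
proof -
  have "adjoint (orth_proj U) = orth_proj U"
    by (rule adjoint_unique) (simp add: inner_orth_proj_symmetric assms)
  then show ?thesis
    by (simp add: singular_space_def restr_adjoint_def orth_proj_id orth_proj_in_orthogonal(1) assms)
qed

lemma inner_orth_proj_orth_proj: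
  assumes "subspace U" "subspace V" "v \<in> V"
  shows "inner v (orth_proj V (orth_proj U w)) = inner (orth_proj U v) (orth_proj U w)"
proof -
  have "inner v (orth_proj V (orth_proj U w)) = inner v (orth_proj U w)"
    by (rule inner_orth_proj_right[OF assms(2,3)])
  also have "\<dots> = inner (orth_proj U v) (orth_proj U w)"
    using inner_orth_proj_symmetric[OF assms(1), of v "orth_proj U w"]
    by (simp add: orth_proj_id assms(1) orth_proj_in_orthogonal(1))
  finally show ?thesis .
qed

lemma linear_orth_proj_comp:
  assumes "subspace U" "subspace V"
  shows "linear (\<lambda>v. orth_proj V (orth_proj U v))"
  using linear_compose[OF linear_orth_proj[OF assms(1)] linear_orth_proj[OF assms(2)]]
  by (simp add: o_def)

lemma subspace_singular_space:
  assumes "subspace U" "subspace V"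
  shows "subspace (singular_space V (orth_proj U) \<sigma>)"
  unfolding singular_space_orth_proj[OF assms] subspace_def
  using assms linear_0[OF linear_orth_proj_comp[OF assms]]
    linear_add[OF linear_orth_proj_comp[OF assms]] linear_scale[OF linear_orth_proj_comp[OF assms]]
  by (auto simp: subspace_0 subspace_add subspace_scale scaleR_add_right)

lemma eigenvalue_eq:
  assumes "subspace U" "subspace V" "v \<in> V" "orth_proj V (orth_proj U v) = \<mu> *\<^sub>R v"
  shows "\<mu> * inner v v = inner (orth_proj U v) (orth_proj U v)"
  using inner_orth_proj_orth_proj[OF assms(1-3), of v] assms(4) by simp

text \<open>An eigenvector for the eigenvalue \<open>1\<close> loses no length under \<open>P\<^sub>U\<close>, so by Pythagoras it lies
  in \<open>U\<close>.\<close>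

lemma singular_space_1:
  assumes "subspace U" "subspace V"
  shows "singular_space V (orth_proj U) 1 = U \<inter> V"
proof
  show "singular_space V (orth_proj U) 1 \<subseteq> U \<inter> V"
  proof
    fix v assume "v \<in> singular_space V (orth_proj U) 1"
    then have v: "v \<in> V" "orth_proj V (orth_proj U v) = 1 *\<^sub>R v"
      by (auto simp: singular_space_orth_proj[OF assms])
    have "inner (v - orth_proj U v) (v - orth_proj U v) = 0"
      using eigenvalue_eq[OF assms v] norm_orth_proj_pythagoras[OF assms(1), of v] by simp
    then have "v = orth_proj U v" by simp
    with orth_proj_in_orthogonal(1)[OF assms(1), of v] v show "v \<in> U \<inter> V" by simp
  qed
  show "U \<inter> V \<subseteq> singular_space V (orth_proj U) 1"
    by (auto simp: singular_space_orth_proj[OF assms] orth_proj_id assms)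
qed

lemma singular_spaces_orthogonal:
  assumes "subspace U" "subspace V" "\<sigma>\<^sup>2 \<noteq> \<tau>\<^sup>2"
    and v: "v \<in> singular_space V (orth_proj U) \<sigma>" and w: "w \<in> singular_space V (orth_proj U) \<tau>"
  shows "inner v w = 0"
proof -
  have vV: "v \<in> V" "orth_proj V (orth_proj U v) = \<sigma>\<^sup>2 *\<^sub>R v"
    and wV: "w \<in> V" "orth_proj V (orth_proj U w) = \<tau>\<^sup>2 *\<^sub>R w"
    using v w by (simp_all add: singular_space_orth_proj assms(1,2))
  have "inner w (orth_proj V (orth_proj U v)) = inner v (orth_proj V (orth_proj U w))"
    using inner_orth_proj_orth_proj[OF assms(1,2)] vV(1) wV(1) by (metis inner_commute)
  then have "\<sigma>\<^sup>2 * inner v w = \<tau>\<^sup>2 * inner v w"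
    by (simp add: vV wV inner_commute[of w])
  with assms(3) show ?thesis by simp
qed

section \<open>The spectral theorem on an invariant subspace\<close>

text \<open>A maximiser \<open>v\<close> of the Rayleigh quotient on the unit sphere of \<open>W\<close> is an eigenvector: with
  \<open>\<mu>\<close> the maximum, the form \<open>\<mu>\<langle>x, y\<rangle> - \<langle>x, T y\<rangle>\<close> is positive semidefinite on \<open>W\<close> and vanishes
  at \<open>v\<close>, so \<open>v\<close> lies in its radical.\<close>

lemma symmetric_operator_has_eigenvector:
  fixes T :: "'a::euclidean_space \<Rightarrow> 'a"
  assumes T: "linear T" and W: "subspace W" "W \<noteq> {0}" and inv: "\<And>x. x \<in> W \<Longrightarrow> T x \<in> W"
    and sym: "\<And>x y. x \<in> W \<Longrightarrow> y \<in> W \<Longrightarrow> inner (T x) y = inner x (T y)"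
  obtains v \<mu> where "v \<in> W" "v \<noteq> 0" "T v = \<mu> *\<^sub>R v"
proof -
  let ?K = "W \<inter> sphere 0 1"
  obtain x where x: "x \<in> W" "x \<noteq> 0" using W subspace_0 by blast
  then have "(1 / norm x) *\<^sub>R x \<in> ?K" using W(1) by (auto simp: subspace_scale)
  then have "?K \<noteq> {}" by blast
  moreover have "compact ?K" using closed_subspace[OF W(1)] by (simp add: closed_Int_compact)
  moreover have "continuous_on ?K (\<lambda>x. inner x (T x))"
    by (intro continuous_intros linear_continuous_on) (simp add: T linear_conv_bounded_linear[symmetric])
  ultimately obtain v where v: "v \<in> ?K" and max: "\<And>y. y \<in> ?K \<Longrightarrow> inner y (T y) \<le> inner v (T v)"
    using continuous_attains_sup[of ?K "\<lambda>x. inner x (T x)"] by blast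
  define \<mu> where "\<mu> = inner v (T v)"
  have vW: "v \<in> W" and vv: "inner v v = 1" using v by (auto simp: norm_eq_1)
  have psd: "inner y (T y) \<le> \<mu> * inner y y" if "y \<in> W" for y
  proof (cases "y = 0")
    case False
    have "(1 / norm y) *\<^sub>R y \<in> ?K" using that W(1) False by (auto simp: subspace_scale)
    from max[OF this] have "inner y (T y) / (norm y)\<^sup>2 \<le> \<mu>"
      by (simp add: \<mu>_def linear_scale[OF T] power2_eq_square)
    with False show ?thesis by (simp add: divide_simps power2_norm_eq_inner split: if_splits)
  qed (simp add: linear_0[OF T])
  have radical: "inner (\<mu> *\<^sub>R v - T v) w = 0" if w: "w \<in> W" for w
  proof -
    let ?b = "inner (\<mu> *\<^sub>R v - T v) w" and ?c = "\<mu> * inner w w - inner w (T w)"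
    have quad: "0 \<le> 2 * t * ?b + t\<^sup>2 * ?c" for t
    proof -
      have "v + t *\<^sub>R w \<in> W" using vW w W(1) by (simp add: subspace_add subspace_scale)
      from psd[OF this] show ?thesis
        using sym[OF vW w] vv
        by (simp add: linear_add[OF T] linear_scale[OF T] inner_add_left inner_add_right
            inner_diff_left \<mu>_def[symmetric] inner_commute power2_eq_square algebra_simps)
    qed
    have c: "0 \<le> ?c" using psd[OF w] by simp
    \<comment> \<open>this \<open>t\<close> makes the linear term beat the quadratic one unless the linear coefficient is \<open>0\<close>\<close>
    have "0 \<le> 2 * (- ?b / (?c + 1)) * ?b + (- ?b / (?c + 1))\<^sup>2 * ?c" by (rule quad)
    also have "\<dots> = - (?b\<^sup>2 * (?c + 2)) / (?c + 1)\<^sup>2"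
      using c by (simp add: divide_simps power2_eq_square) algebra
    finally have "?b\<^sup>2 * (?c + 2) / (?c + 1)\<^sup>2 \<le> 0" by simp
    moreover have "0 < (?c + 1)\<^sup>2" using c by simp
    ultimately have "?b\<^sup>2 * (?c + 2) \<le> 0" by (simp only: divide_le_0_iff) linarith
    with c show ?thesis by (simp add: mult_le_0_iff)
  qed
  have "\<mu> *\<^sub>R v - T v \<in> W" using vW inv W(1) by (simp add: subspace_diff subspace_scale)
  from radical[OF this] have "T v = \<mu> *\<^sub>R v" by simp
  moreover have "v \<noteq> 0" using vv by auto
  ultimately show ?thesis using vW that by blast
qed

text \<open>The part of \<open>V\<close> orthogonal to all eigenvectors is invariant and contains no eigenvector, so
  it is zero.\<close>

lemma symmetric_operator_eigenvectors_span:
  fixes T :: "'a::euclidean_space \<Rightarrow> 'a"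
  assumes T: "linear T" and V: "subspace V" and inv: "\<And>x. x \<in> V \<Longrightarrow> T x \<in> V"
    and sym: "\<And>x y. x \<in> V \<Longrightarrow> y \<in> V \<Longrightarrow> inner (T x) y = inner x (T y)"
  shows "V \<subseteq> span {v \<in> V. \<exists>\<mu>. T v = \<mu> *\<^sub>R v}"
proof
  let ?E = "{v \<in> V. \<exists>\<mu>. T v = \<mu> *\<^sub>R v}"
  let ?W = "{x \<in> V. \<forall>e\<in>?E. inner x e = 0}"
  have W: "subspace ?W"
    using V by (auto simp: subspace_def inner_add_left)
  have W_inv: "T x \<in> ?W" if "x \<in> ?W" for x
  proof -
    have "inner (T x) e = 0" if "e \<in> ?E" for e
      using \<open>x \<in> ?W\<close> that sym[of x e] by auto
    with that inv show ?thesis by blast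
  qed
  have W0: "?W = {0}"
  proof (rule ccontr)
    assume "?W \<noteq> {0}"
    then obtain v \<mu> where "v \<in> ?W" "v \<noteq> 0" "T v = \<mu> *\<^sub>R v"
      using symmetric_operator_has_eigenvector[OF T W _ W_inv] sym by (metis (no_types, lifting) mem_Collect_eq)
    then have "inner v v = 0" by blast
    with \<open>v \<noteq> 0\<close> show False by simp
  qed
  fix x assume x: "x \<in> V"
  obtain y z where yz: "y \<in> span ?E" "\<And>w. w \<in> span ?E \<Longrightarrow> orthogonal z w" "x = y + z"
    using orthogonal_subspace_decomp_exists[of ?E x] by blast
  have "span ?E \<subseteq> V" using V by (intro span_minimal) auto
  then have "x - y \<in> V" using x yz(1) by (intro subspace_diff[OF V]) auto
  then have "z \<in> V" using yz(3) by simp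
  then have "z \<in> ?W" using yz(2) by (auto simp: orthogonal_def span_base)
  with W0 yz show "x \<in> span ?E" by auto
qed

section \<open>The Friedrichs angle and the largest principal angle\<close>

definition singular_value_set :: "'a::euclidean_space set \<Rightarrow> 'a set \<Rightarrow> real set" where
  "singular_value_set U V = {\<sigma>. 0 \<le> \<sigma> \<and> (\<exists>v\<in>singular_space V (orth_proj U) \<sigma>. v \<noteq> 0)}"

lemma finite_singular_value_set:
  assumes "subspace U" "subspace V"
  shows "finite (singular_value_set U V)"
  unfolding singular_value_set_def
  using finite_singular_values[OF assms(2) linear_orth_proj[OF assms(1)]] .

lemma singular_value_bounds:
  assumes "subspace U" "subspace V" "\<sigma> \<in> singular_value_set U V"
  shows "0 \<le> \<sigma>" "\<sigma> \<le> 1"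
proof -
  obtain v where "v \<in> V" "v \<noteq> 0" "orth_proj V (orth_proj U v) = \<sigma>\<^sup>2 *\<^sub>R v" and \<sigma>: "0 \<le> \<sigma>"
    using assms by (auto simp: singular_value_set_def singular_space_orth_proj)
  then have "\<sigma>\<^sup>2 * inner v v \<le> 1 * inner v v"
    using eigenvalue_eq[OF assms(1,2), of v "\<sigma>\<^sup>2"] norm_orth_proj_pythagoras[OF assms(1), of v]
    by simp
  moreover have "0 < inner v v" using \<open>v \<noteq> 0\<close> by simp
  ultimately have "\<sigma>\<^sup>2 \<le> 1" by (rule mult_right_le_imp_le)
  then show "\<sigma> \<le> 1" by (simp add: abs_square_le_1)
  show "0 \<le> \<sigma>" by fact
qed

lemma span_singular_spaces:
  assumes U: "subspace U" and V: "subspace V"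
  shows "V = span (\<Union>\<sigma>\<in>singular_value_set U V. singular_space V (orth_proj U) \<sigma>)" (is "V = span ?E")
proof
  show "span ?E \<subseteq> V"
    using V by (intro span_minimal) (auto simp: singular_space_def)
  let ?T = "\<lambda>v. orth_proj V (orth_proj U v)"
  have "V \<subseteq> span {v \<in> V. \<exists>\<mu>. ?T v = \<mu> *\<^sub>R v}"
  proof (rule symmetric_operator_eigenvectors_span)
    show "linear ?T" by (rule linear_orth_proj_comp[OF assms])
    show "?T x \<in> V" for x by (rule orth_proj_in_orthogonal(1)[OF V])
    show "inner (?T x) y = inner x (?T y)" if "x \<in> V" "y \<in> V" for x y
      using inner_orth_proj_orth_proj[OF U V that(1), of y] inner_orth_proj_orth_proj[OF U V that(2), of x]
      by (metis inner_commute)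
  qed (rule V)
  also have "\<dots> \<subseteq> span ?E"
  proof (rule span_minimal)
    show "{v \<in> V. \<exists>\<mu>. ?T v = \<mu> *\<^sub>R v} \<subseteq> span ?E"
    proof clarify
      fix v \<mu> assume v: "v \<in> V" "?T v = \<mu> *\<^sub>R v"
      show "v \<in> span ?E"
      proof (cases "v = 0")
        case False
        have "0 \<le> \<mu> * inner v v" using eigenvalue_eq[OF U V v] by simp
        with False have "0 \<le> \<mu>" by (metis inner_gt_zero_iff not_less zero_le_mult_iff)
        with v have "v \<in> singular_space V (orth_proj U) (sqrt \<mu>)"
          by (simp add: singular_space_orth_proj U V)
        moreover from this have "sqrt \<mu> \<in> singular_value_set U V"
          using False \<open>0 \<le> \<mu>\<close> by (auto simp: singular_value_set_def)
        ultimately show ?thesis by (blast intro: span_base)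
      qed (simp add: span_0)
    qed
  qed simp
  finally show "V \<subseteq> span ?E" .
qed

text \<open>Orthonormal bases of the mutually orthogonal singular spaces combine to a basis of \<open>V\<close>.\<close>

lemma sum_dim_singular_spaces:
  assumes U: "subspace U" and V: "subspace V"
  shows "(\<Sum>\<sigma>\<in>singular_value_set U V. dim (singular_space V (orth_proj U) \<sigma>)) = dim V"
proof -
  let ?S = "singular_value_set U V" and ?E = "singular_space V (orth_proj U)"
  have "\<exists>B. B \<subseteq> ?E \<sigma> \<and> pairwise orthogonal B \<and> 0 \<notin> B \<and> finite B \<and> card B = dim (?E \<sigma>)
          \<and> span B = ?E \<sigma>" for \<sigma>
    using orthonormal_basis_subspace[OF subspace_singular_space[OF U V, of \<sigma>]]
    by (metis norm_zero zero_neq_one independent_imp_finite)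
  then obtain B where B: "\<And>\<sigma>. B \<sigma> \<subseteq> ?E \<sigma>" "\<And>\<sigma>. pairwise orthogonal (B \<sigma>)" "\<And>\<sigma>. 0 \<notin> B \<sigma>"
    "\<And>\<sigma>. finite (B \<sigma>)" "\<And>\<sigma>. card (B \<sigma>) = dim (?E \<sigma>)" "\<And>\<sigma>. span (B \<sigma>) = ?E \<sigma>"
    by metis
  have orth: "inner v w = 0" if "\<sigma> \<in> ?S" "\<tau> \<in> ?S" "\<sigma> \<noteq> \<tau>" "v \<in> B \<sigma>" "w \<in> B \<tau>" for \<sigma> \<tau> v w
  proof -
    have "\<sigma>\<^sup>2 \<noteq> \<tau>\<^sup>2" using that(1-3) by (auto simp: power2_eq_iff singular_value_set_def)
    then show ?thesis using singular_spaces_orthogonal[OF U V] that(4,5) B(1) by blast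
  qed
  have disj: "B \<sigma> \<inter> B \<tau> = {}" if "\<sigma> \<in> ?S" "\<tau> \<in> ?S" "\<sigma> \<noteq> \<tau>" for \<sigma> \<tau>
    using orth[OF that] B(3) by (metis disjoint_iff inner_eq_zero_iff)
  have "pairwise orthogonal (\<Union>\<sigma>\<in>?S. B \<sigma>)"
    unfolding pairwise_def orthogonal_def
  proof clarify
    fix v w \<sigma> \<tau> assume *: "\<sigma> \<in> ?S" "v \<in> B \<sigma>" "\<tau> \<in> ?S" "w \<in> B \<tau>" "v \<noteq> w"
    show "inner v w = 0"
    proof (cases "\<sigma> = \<tau>")
      case True
      with * B(2)[of \<sigma>] show ?thesis by (auto simp: pairwise_def orthogonal_def)
    qed (use * orth in blast)
  qed
  moreover have "0 \<notin> (\<Union>\<sigma>\<in>?S. B \<sigma>)" using B(3) by blast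
  ultimately have ind: "independent (\<Union>\<sigma>\<in>?S. B \<sigma>)" by (rule pairwise_orthogonal_independent)
  have "span (\<Union>\<sigma>\<in>?S. B \<sigma>) = V"
  proof
    show "span (\<Union>\<sigma>\<in>?S. B \<sigma>) \<subseteq> V"
      using B(1) V by (intro span_minimal) (auto simp: singular_space_def)
    have "?E \<sigma> \<subseteq> span (\<Union>\<sigma>\<in>?S. B \<sigma>)" if "\<sigma> \<in> ?S" for \<sigma>
      unfolding B(6)[symmetric] using that by (intro span_mono) blast
    then have "span (\<Union>\<sigma>\<in>?S. ?E \<sigma>) \<subseteq> span (\<Union>\<sigma>\<in>?S. B \<sigma>)"
      by (intro span_minimal) auto
    then show "V \<subseteq> span (\<Union>\<sigma>\<in>?S. B \<sigma>)" using span_singular_spaces[OF U V] by simp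
  qed
  then have "dim V = card (\<Union>\<sigma>\<in>?S. B \<sigma>)" using dim_span_eq_card_independent[OF ind] by simp
  also have "\<dots> = (\<Sum>\<sigma>\<in>?S. card (B \<sigma>))"
    using disj B(4) finite_singular_value_set[OF U V] by (intro card_UN_disjoint) auto
  finally show ?thesis by (simp add: B(5))
qed

text \<open>The singular values other than \<open>1\<close> are the cosines of the nonzero principal angles.\<close>

definition proper_singular_values :: "'a::euclidean_space set \<Rightarrow> 'a set \<Rightarrow> real set" where
  "proper_singular_values U V = singular_value_set U V - {1}"

lemma concat_replicate_head_last:
  assumes "finite A" "A \<noteq> {}" "\<And>a. a \<in> A \<Longrightarrow> 0 < m a"
  defines "xs \<equiv> concat (map (\<lambda>a. replicate (m a) a) (rev (sorted_list_of_set A)))"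
  shows "xs \<noteq> []" "hd xs = Max A" "last xs = (Min A :: 'a::linorder)"
    "length xs = sum m A"
proof -
  have sorted: "sorted_wrt (\<ge>) xs" if "sorted_wrt (\<ge>) ys"
    "xs = concat (map (\<lambda>a. replicate (m a) a) ys)" for xs ys :: "'a list"
    using that by (induction ys arbitrary: xs) (auto simp: sorted_wrt_append sorted_wrt_iff_nth_less[of _ "replicate _ _"])
  have set: "set xs = A" using assms(1,3) by (auto simp: xs_def set_replicate_conv_if)
  then show ne: "xs \<noteq> []" using assms(2) by auto
  have desc: "sorted_wrt (\<ge>) xs"
    by (rule sorted[of "rev (sorted_list_of_set A)"]) (simp_all add: sorted_wrt_rev xs_def)
  have nth: "xs ! j \<le> xs ! i" if "i \<le> j" "j < length xs" for i j
    using sorted_wrt_nth_less[OF desc, of i j] that by (cases "i = j") auto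
  show "hd xs = Max A"
    unfolding set[symmetric] using ne nth[of 0]
    by (intro Max_eqI[symmetric]) (auto simp: hd_conv_nth in_set_conv_nth)
  have "last xs \<le> x" if "x \<in> set xs" for x
    using that ne nth[of _ "length xs - 1"] by (auto simp: last_conv_nth in_set_conv_nth)
  then show "last xs = Min A"
    unfolding set[symmetric] using ne by (intro Min_eqI[symmetric]) simp_all
  show "length xs = sum m A"
    unfolding xs_def using assms(1)
    by (simp add: length_concat o_def rev_map[symmetric] sum_list_rev sum_list_distinct_conv_sum_set)
qed

lemma singular_values_split:
  assumes U: "subspace U" and V: "subspace V"
  shows "singular_values V (orth_proj U) = replicate (dim (U \<inter> V)) 1 @
    concat (map (\<lambda>\<sigma>. replicate (dim (singular_space V (orth_proj U) \<sigma>)) \<sigma>)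
       (rev (sorted_list_of_set (proper_singular_values U V))))"
proof -
  let ?S = "singular_value_set U V" and ?S' = "proper_singular_values U V"
  have fin: "finite ?S" "finite ?S'"
    using finite_singular_value_set[OF U V] by (auto simp: proper_singular_values_def)
  have one: "1 \<in> ?S \<longleftrightarrow> dim (U \<inter> V) \<noteq> 0"
    by (auto simp: singular_value_set_def singular_space_1[OF U V])
  show ?thesis
  proof (cases "1 \<in> ?S")
    case True
    have "sorted_list_of_set ?S = sorted_list_of_set ?S' @ [1]"
      by (rule sorted_distinct_set_unique)
        (use fin True singular_value_bounds[OF U V] in
          \<open>auto simp: sorted_append proper_singular_values_def\<close>)
    then show ?thesis
      by (simp add: singular_values_def singular_value_set_def[symmetric] singular_space_1[OF U V])
  next
    case False
    then have "?S' = ?S" by (simp add: proper_singular_values_def)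
    with False one show ?thesis
      by (simp add: singular_values_def singular_value_set_def[symmetric])
  qed
qed

lemma proper_singular_values_nonempty:
  assumes U: "subspace U" and V: "subspace V" and "\<not> V \<subseteq> U"
  shows "proper_singular_values U V \<noteq> {}"
proof
  assume "proper_singular_values U V = {}"
  then have "(\<Union>\<sigma>\<in>singular_value_set U V. singular_space V (orth_proj U) \<sigma>) \<subseteq> U \<inter> V"
    using singular_space_1[OF U V] by (auto simp: proper_singular_values_def)
  then have "V \<subseteq> U \<inter> V"
    using span_singular_spaces[OF U V] span_minimal[OF _ subspace_inter[OF U V]] by metis
  with assms(3) show False by blast
qed

text \<open>The ones fill exactly the first \<open>dim (U \<inter> V)\<close> places of the list, so \<open>\<theta>\<^sub>F\<close> is read off at the
  first value below \<open>1\<close>. Since the multiplicities add up to \<open>dim V\<close>, \<open>\<theta>\<^sub>p\<close> is read off at the last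
  entry.\<close>

lemma extreme_angles:
  assumes U: "subspace U" and V: "subspace V" and VU: "\<not> V \<subseteq> U"
  shows "friedrichs_angle U V = arccos (Max (proper_singular_values U V))"
    and "principal_angle U V (dim V) = arccos (Min (proper_singular_values U V))"
proof -
  let ?S = "singular_value_set U V" and ?S' = "proper_singular_values U V"
  let ?m = "\<lambda>\<sigma>. dim (singular_space V (orth_proj U) \<sigma>)"
  let ?xs = "concat (map (\<lambda>\<sigma>. replicate (?m \<sigma>) \<sigma>) (rev (sorted_list_of_set ?S')))"
  have fin: "finite ?S" "finite ?S'"
    using finite_singular_value_set[OF U V] by (auto simp: proper_singular_values_def)
  have pos: "0 < ?m \<sigma>" if "\<sigma> \<in> ?S'" for \<sigma>
    using that by (auto simp: proper_singular_values_def singular_value_set_def intro!: Nat.gr0I)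
  note xs = concat_replicate_head_last[OF fin(2) proper_singular_values_nonempty[OF assms],
      where m = ?m, OF pos]
  have "dim V = dim (U \<inter> V) + sum ?m ?S'"
  proof (cases "1 \<in> ?S")
    case True
    then show ?thesis
      using sum.remove[OF fin(1) True, of ?m] sum_dim_singular_spaces[OF U V]
      by (simp add: proper_singular_values_def singular_space_1[OF U V])
  next
    case False
    then have "dim (U \<inter> V) = 0"
      by (auto simp: singular_value_set_def singular_space_1[OF U V])
    with False show ?thesis
      using sum_dim_singular_spaces[OF U V] by (simp add: proper_singular_values_def)
  qed
  then have "dim V = dim (U \<inter> V) + length ?xs" by (simp only: xs(4))
  moreover obtain ys where ys: "ys = ?xs" by blast
  ultimately have dim: "dim V = dim (U \<inter> V) + length ys" by simp
  have split: "singular_values V (orth_proj U) = replicate (dim (U \<inter> V)) 1 @ ys"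
    unfolding ys by (rule singular_values_split[OF U V])
  have ne: "ys \<noteq> []" and ends: "hd ys = Max ?S'" "last ys = Min ?S'"
    unfolding ys by (rule xs, assumption)+
  have "dim V - 1 = dim (U \<inter> V) + (length ys - 1)"
    using dim ne by (cases ys) auto
  then show "friedrichs_angle U V = arccos (Max ?S')"
    "principal_angle U V (dim V) = arccos (Min ?S')"
    using ends hd_conv_nth[OF ne] last_conv_nth[OF ne]
    by (simp_all add: friedrichs_angle_def principal_angle_def split nth_append)
qed

lemma extreme_singular_values:
  assumes U: "subspace U" and V: "subspace V" and VU: "\<not> V \<subseteq> U"
  shows "Max (proper_singular_values U V) \<in> {0..1}" "Min (proper_singular_values U V) \<in> {0..1}"
proof -
  have "finite (proper_singular_values U V)"
    using finite_singular_value_set[OF U V] by (simp add: proper_singular_values_def)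
  from Max_in[OF this proper_singular_values_nonempty[OF assms]]
    Min_in[OF this proper_singular_values_nonempty[OF assms]]
  have "Max (proper_singular_values U V) \<in> singular_value_set U V"
    "Min (proper_singular_values U V) \<in> singular_value_set U V"
    by (simp_all only: proper_singular_values_def[of U V] Diff_iff)
  then show "Max (proper_singular_values U V) \<in> {0..1}" "Min (proper_singular_values U V) \<in> {0..1}"
    using singular_value_bounds[OF U V] by simp_all
qed

lemma angles_eq_iff_extreme_eq:
  assumes U: "subspace U" and V: "subspace V" and VU: "\<not> V \<subseteq> U"
  shows "friedrichs_angle U V = principal_angle U V (dim V) \<longleftrightarrow>
    Max (proper_singular_values U V) = Min (proper_singular_values U V)"
  using extreme_singular_values[OF assms]
  by (auto simp: extreme_angles[OF assms] arccos_eq_iff)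

text \<open>With \<open>sin\<^sup>2 (arccos a) = 1 - a\<^sup>2\<close>, only the numerator \<open>a\<^sup>2 - b\<^sup>2\<close> matters: the denominator could
  vanish only for \<open>a = b = 1\<close>, where the numerator vanishes as well.\<close>

lemma rho_eq_0_iff_extreme_eq:
  assumes U: "subspace U" and V: "subspace V" and VU: "\<not> V \<subseteq> U"
  shows "rho U V = 0 \<longleftrightarrow> Max (proper_singular_values U V) = Min (proper_singular_values U V)"
proof -
  define a b where "a = Max (proper_singular_values U V)" and "b = Min (proper_singular_values U V)"
  have ab: "0 \<le> a" "a \<le> 1" "0 \<le> b" "b \<le> 1"
    using extreme_singular_values[OF assms] by (auto simp: a_def b_def)
  then have "(sin (arccos a))\<^sup>2 = 1 - a\<^sup>2" "(sin (arccos b))\<^sup>2 = 1 - b\<^sup>2"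
    by (simp_all add: sin_squared_eq)
  then have "rho U V = (a\<^sup>2 - b\<^sup>2) / ((1 - b\<^sup>2) + (1 - a\<^sup>2))"
    by (simp add: rho_def extreme_angles[OF assms] a_def[symmetric] b_def[symmetric])
  moreover have "a\<^sup>2 \<le> 1" "b\<^sup>2 \<le> 1" using ab by (simp_all add: power_le_one)
  ultimately have "rho U V = 0 \<longleftrightarrow> a\<^sup>2 = b\<^sup>2"
    by auto
  also have "\<dots> \<longleftrightarrow> a = b" using ab by (auto simp: power2_eq_iff)
  finally show ?thesis by (simp add: a_def b_def)
qed

section \<open>Equal angles and scalar \<open>M\<close>\<close>

lemma ortho_part_memI:
  assumes "subspace U" "subspace V" "x \<in> V"
  shows "x - orth_proj (U \<inter> V) x \<in> V \<inter> (U \<inter> V)\<^sup>\<bottom>"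
  using assms orth_proj_in_orthogonal(1)[OF subspace_inter[OF assms(1,2)], of x]
    orth_proj_in_orthogonal(2)[OF subspace_inter[OF assms(1,2)], of _ x]
  by (auto simp: orthogonal_comp_def orthogonal_def subspace_diff inner_commute[of _ "x - _"])

lemma ortho_part_nonzero:
  fixes U V :: "'a::euclidean_space set"
  assumes U: "subspace U" and V: "subspace V" and "\<not> V \<subseteq> U"
  obtains v where "v \<in> V \<inter> (U \<inter> V)\<^sup>\<bottom>" "v \<noteq> 0"
proof -
  obtain x where x: "x \<in> V" "x \<notin> U" using assms(3) by blast
  have "orth_proj (U \<inter> V) x \<in> U"
    using orth_proj_in_orthogonal(1)[OF subspace_inter[OF U V], of x] by blast
  then have "x - orth_proj (U \<inter> V) x \<noteq> 0" using x by auto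
  with ortho_part_memI[OF U V x(1)] that show ?thesis by blast
qed

lemma inner_M_op:
  assumes "subspace U" "subspace V" "v \<in> V"
  shows "inner v (M_op U V v) = inner (v - orth_proj U v) (v - orth_proj U v)"
  using norm_orth_proj_pythagoras[OF assms(1), of v] inner_orth_proj_orth_proj[OF assms, of v]
  by (simp add: M_op_def inner_diff_right)

lemma singular_space_subset_ortho_part:
  assumes "subspace U" "subspace V" "\<sigma> \<in> proper_singular_values U V"
  shows "singular_space V (orth_proj U) \<sigma> \<subseteq> V \<inter> (U \<inter> V)\<^sup>\<bottom>"
proof -
  have "\<sigma>\<^sup>2 \<noteq> 1\<^sup>2"
    using assms(3) unfolding power2_eq_iff
    by (auto simp: proper_singular_values_def singular_value_set_def)
  from singular_spaces_orthogonal[OF assms(1,2) this] show ?thesis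
    unfolding singular_space_1[OF assms(1,2)]
    by (auto simp: orthogonal_comp_def orthogonal_def inner_commute singular_space_def)
qed

text \<open>On a singular space \<open>M\<close> is \<open>1 - \<sigma>\<^sup>2\<close>. If only one \<open>\<sigma> < 1\<close> occurs, \<open>V\<close> is the orthogonal sum
  of \<open>U \<inter> V\<close> and its singular space, which is therefore all of \<open>V \<inter> (U \<inter> V)\<^sup>\<bottom>\<close>. Conversely, a
  scalar \<open>M\<close> has a single eigenvalue there.\<close>

lemma extreme_eq_iff_M_scalar:
  assumes U: "subspace U" and V: "subspace V" and VU: "\<not> V \<subseteq> U"
  shows "Max (proper_singular_values U V) = Min (proper_singular_values U V) \<longleftrightarrow> M_scalar U V"
proof
  let ?S' = "proper_singular_values U V" and ?E = "singular_space V (orth_proj U)"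
  have fin: "finite ?S'"
    using finite_singular_value_set[OF U V] by (simp add: proper_singular_values_def)
  note ne = proper_singular_values_nonempty[OF assms]
  assume eq: "Max ?S' = Min ?S'"
  define \<tau> where "\<tau> = Max ?S'"
  have \<tau>: "\<tau> \<in> ?S'" using fin ne by (simp add: \<tau>_def)
  have all: "\<sigma> = \<tau>" if "\<sigma> \<in> ?S'" for \<sigma>
    using Max_ge[OF fin that] Min_le[OF fin that] eq by (simp add: \<tau>_def)
  have "M_op U V v = (1 - \<tau>\<^sup>2) *\<^sub>R v" if v: "v \<in> V \<inter> (U \<inter> V)\<^sup>\<bottom>" for v
  proof -
    have "(\<Union>\<sigma>\<in>singular_value_set U V. ?E \<sigma>) \<subseteq> (U \<inter> V) \<union> ?E \<tau>"
      using all singular_space_1[OF U V] by (auto simp: proper_singular_values_def)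
    then have "v \<in> span ((U \<inter> V) \<union> ?E \<tau>)"
      using v span_singular_spaces[OF U V] span_mono by blast
    then obtain a b where ab: "a \<in> U \<inter> V" "b \<in> ?E \<tau>" "v = a + b"
      unfolding span_Un using span_eq_iff[THEN iffD2, OF subspace_inter[OF U V]]
        span_eq_iff[THEN iffD2, OF subspace_singular_space[OF U V, of \<tau>]] by auto
    have "inner a v = 0" "inner a b = 0"
      using v ab singular_space_subset_ortho_part[OF U V \<tau>]
      by (auto simp: orthogonal_comp_def orthogonal_def)
    with ab have "a = 0" by (simp add: inner_add_right)
    with ab show ?thesis
      by (simp add: M_op_def singular_space_orth_proj[OF U V] algebra_simps)
  qed
  moreover have "0 < 1 - \<tau>\<^sup>2"
    using \<tau> singular_value_bounds[OF U V, of \<tau>]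
    by (auto simp: proper_singular_values_def abs_square_less_1)
  ultimately show "M_scalar U V" unfolding M_scalar_def by blast
next
  let ?S' = "proper_singular_values U V" and ?E = "singular_space V (orth_proj U)"
  assume "M_scalar U V"
  then obtain c where c: "\<And>v. v \<in> V \<inter> (U \<inter> V)\<^sup>\<bottom> \<Longrightarrow> M_op U V v = c *\<^sub>R v"
    by (auto simp: M_scalar_def)
  have sq: "\<sigma>\<^sup>2 = 1 - c" if "\<sigma> \<in> ?S'" for \<sigma>
  proof -
    obtain v where v: "v \<in> ?E \<sigma>" "v \<noteq> 0"
      using \<open>\<sigma> \<in> ?S'\<close> by (auto simp: proper_singular_values_def singular_value_set_def)
    then have "(1 - \<sigma>\<^sup>2) *\<^sub>R v = c *\<^sub>R v"
      using c[of v] singular_space_subset_ortho_part[OF U V that]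
      by (auto simp: M_op_def singular_space_orth_proj[OF U V] algebra_simps)
    with v show ?thesis by simp
  qed
  have "\<sigma> = sqrt (1 - c)" if "\<sigma> \<in> ?S'" for \<sigma>
    unfolding sq[OF that, symmetric]
    using that by (simp add: proper_singular_values_def singular_value_set_def)
  with proper_singular_values_nonempty[OF assms] have "?S' = {sqrt (1 - c)}" by auto
  then show "Max ?S' = Min ?S'" by simp
qed

section \<open>One-step convergence and scalar \<open>M\<close>\<close>

text \<open>A reflection only flips the sign of the component orthogonal to \<open>W\<close>.\<close>

lemma dist_reflect:
  assumes "subspace W" "w \<in> W"
  shows "dist w (reflect W x) = dist w x"
proof -
  let ?p = "orth_proj W x"
  have "?p - w \<in> W" using assms by (simp add: orth_proj_in_orthogonal(1) subspace_diff)
  then have 0: "inner (x - ?p) (?p - w) = 0" by (rule orth_proj_in_orthogonal[OF assms(1)])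
  have "reflect W x - w = (?p - w) - (x - ?p)" by (simp add: reflect_def scaleR_2)
  moreover have "x - w = (?p - w) + (x - ?p)" by simp
  moreover have "norm (d - r) = norm (d + r)" if "inner r d = 0" for d r :: 'a
    using that by (simp add: norm_eq_sqrt_inner inner_add_left inner_add_right inner_diff_left
        inner_diff_right inner_commute[of d r])
  ultimately have "norm (reflect W x - w) = norm (x - w)" using 0 by metis
  then show ?thesis by (metis dist_commute dist_norm)
qed

text \<open>The target \<open>w\<close> is equidistant from the three vertices, so it is the circumcenter iff it lies in
  their affine hull. That hull is \<open>x + span {P\<^sub>U x - x, M x}\<close>, and \<open>P\<^sub>V\<close>, which fixes \<open>x\<close> and \<open>w\<close>,
  maps it to the line \<open>x + span {M x}\<close>, itself a part of the hull.\<close>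

lemma C_T_eq_proj_iff:
  assumes U: "subspace U" and V: "subspace V" and x: "x \<in> V"
  defines "w \<equiv> orth_proj (U \<inter> V) x"
  shows "C_T U V x = w \<longleftrightarrow> (\<exists>c. x - w = c *\<^sub>R M_op U V x)"
proof -
  let ?u = "orth_proj U x"
  let ?t = "orth_proj V ?u"
  let ?A = "{x, reflect U x, reflect V (reflect U x)}"
  note lin = linear_orth_proj[OF V]
  have w: "w \<in> U" "w \<in> V"
    using orth_proj_in_orthogonal(1)[OF subspace_inter[OF U V], of x] by (auto simp: w_def)
  have PVx: "orth_proj V x = x" "orth_proj V w = w" "orth_proj V ?t = ?t"
    using x w V by (simp_all add: orth_proj_id orth_proj_in_orthogonal(1))
  have RU: "reflect U x = 2 *\<^sub>R ?u - x" by (simp add: reflect_def)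
  have RV: "reflect V (reflect U x) = 4 *\<^sub>R ?t - 2 *\<^sub>R ?u - x"
    by (simp add: RU reflect_def[of V] linear_diff[OF lin] linear_scale[OF lin] PVx algebra_simps flip: scaleR_2)
  have "C_T U V x = orth_proj (affine hull ?A) w"
    unfolding C_T_def by (rule circumcenter_eq) (auto simp: dist_reflect U V w)
  moreover have "orth_proj (affine hull ?A) w \<in> affine hull ?A"
    using closest_point_in_set[of "affine hull ?A" w]
    by (simp add: orth_proj_eq_closest_point affine_closed)
  moreover have "orth_proj (affine hull ?A) w = w" if "w \<in> affine hull ?A"
    using that by (intro orth_proj_unique) (auto simp: orthogonal_def)
  ultimately have "C_T U V x = w \<longleftrightarrow> w \<in> affine hull ?A" by metis
  also have "\<dots> \<longleftrightarrow> (\<exists>c. x - w = c *\<^sub>R M_op U V x)"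
  proof
    assume "w \<in> affine hull ?A"
    then obtain a b c where abc: "a + b + c = 1"
      "w = a *\<^sub>R x + b *\<^sub>R (2 *\<^sub>R ?u - x) + c *\<^sub>R (4 *\<^sub>R ?t - 2 *\<^sub>R ?u - x)"
      unfolding affine_hull_3 RV unfolding RU by blast
    have "w = orth_proj V (a *\<^sub>R x + b *\<^sub>R (2 *\<^sub>R ?u - x) + c *\<^sub>R (4 *\<^sub>R ?t - 2 *\<^sub>R ?u - x))"
      using abc(2) PVx(2) by simp
    also have "\<dots> = a *\<^sub>R x + b *\<^sub>R (2 *\<^sub>R ?t - x) + c *\<^sub>R (4 *\<^sub>R ?t - 2 *\<^sub>R ?t - x)"
      by (simp add: linear_add[OF lin] linear_diff[OF lin] linear_scale[OF lin] PVx)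
    also have "\<dots> = (a + b + c) *\<^sub>R x - (2 * (b + c)) *\<^sub>R M_op U V x"
      by (simp add: M_op_def algebra_simps flip: scaleR_add_left)
    finally show "\<exists>c. x - w = c *\<^sub>R M_op U V x"
      using abc(1) by (intro exI[of _ "2 * (b + c)"]) simp
  next
    assume "\<exists>c. x - w = c *\<^sub>R M_op U V x"
    then obtain c where "x - w = c *\<^sub>R M_op U V x" by blast
    then have "w = x - c *\<^sub>R M_op U V x" by (simp add: algebra_simps)
    \<comment> \<open>equal weights on the two reflected points cancel the component along \<open>P\<^sub>U x\<close>\<close>
    also have "\<dots> = (1 - c / 2) *\<^sub>R x + (c / 4) *\<^sub>R (2 *\<^sub>R ?u - x)
        + (c / 4) *\<^sub>R (4 *\<^sub>R ?t - 2 *\<^sub>R ?u - x)"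
      by (simp add: M_op_def algebra_simps flip: scaleR_add_left)
    finally have "w = (1 - c / 2) *\<^sub>R x + (c / 4) *\<^sub>R (2 *\<^sub>R ?u - x)
        + (c / 4) *\<^sub>R (4 *\<^sub>R ?t - 2 *\<^sub>R ?u - x)" .
    moreover have "(1 - c / 2) + c / 4 + c / 4 = 1" by simp
    ultimately show "w \<in> affine hull ?A"
      unfolding affine_hull_3 RV unfolding RU mem_Collect_eq by (intro exI conjI)
  qed
  finally show ?thesis .
qed

lemma linear_M_op:
  assumes "subspace U" "subspace V"
  shows "linear (M_op U V)"
proof -
  have "M_op U V = (\<lambda>v. v - orth_proj V (orth_proj U v))" by (simp add: fun_eq_iff M_op_def)
  then show ?thesis
    using linear_compose_sub[OF linear_ident linear_orth_proj_comp[OF assms]] by simp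
qed

text \<open>If \<open>v\<close>, \<open>w\<close> had distinct eigenvalues, comparing the values at \<open>v\<close>, \<open>w\<close> and \<open>v + w\<close> would give
  a relation \<open>a v = b w\<close> in which \<open>a + b\<close> is the difference of the eigenvalues of \<open>w\<close> and \<open>v\<close>;
  applying \<open>f\<close> to it forces \<open>a = b = 0\<close>.\<close>

lemma all_eigenvectors_imp_scalar:
  fixes f :: "'a::real_vector \<Rightarrow> 'a"
  assumes f: "linear f" and W: "subspace W" and eig: "\<And>v. v \<in> W \<Longrightarrow> \<exists>c. f v = c *\<^sub>R v"
  shows "\<exists>c. \<forall>v\<in>W. f v = c *\<^sub>R v"
proof -
  obtain l where l: "\<And>v. v \<in> W \<Longrightarrow> f v = l v *\<^sub>R v" using eig by metis
  have same: "l v = l w" if v: "v \<in> W" "v \<noteq> 0" and w: "w \<in> W" "w \<noteq> 0" for v w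
  proof (rule ccontr)
    assume ne: "l v \<noteq> l w"
    define a b where "a = l (v + w) - l v" and "b = l w - l (v + w)"
    have "v + w \<in> W" using v w W by (simp add: subspace_add)
    then have "l (v + w) *\<^sub>R (v + w) = l v *\<^sub>R v + l w *\<^sub>R w"
      using l v(1) w(1) by (metis linear_add[OF f])
    then have rel: "a *\<^sub>R v = b *\<^sub>R w" by (simp add: a_def b_def algebra_simps)
    have "l v *\<^sub>R (a *\<^sub>R v) = f (a *\<^sub>R v)" by (simp add: linear_scale[OF f] l v mult.commute)
    also have "\<dots> = l w *\<^sub>R (a *\<^sub>R v)" by (simp add: rel linear_scale[OF f] l w mult.commute)
    finally have "a = 0" using ne v by simp
    with rel w have "b = 0" by simp
    with \<open>a = 0\<close> ne show False by (simp add: a_def b_def)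
  qed
  show ?thesis
  proof (cases "W \<subseteq> {0}")
    case True
    then have "\<forall>v\<in>W. f v = 0 *\<^sub>R v" using linear_0[OF f] by auto
    then show ?thesis ..
  next
    case False
    then obtain u where u: "u \<in> W" "u \<noteq> 0" by blast
    have "f v = l u *\<^sub>R v" if "v \<in> W" for v
      using l[OF that] same[OF that _ u] linear_0[OF f] by (cases "v = 0") auto
    then show ?thesis by blast
  qed
qed

lemma one_step_convergence_iff:
  assumes U: "subspace U" and V: "subspace V"
  shows "one_step_convergence U V \<longleftrightarrow> (\<forall>x\<in>V. C_T U V x = orth_proj (U \<inter> V) x)"
proof -
  have eq: "orth_proj (U \<inter> V) (orth_proj V x) = orth_proj (U \<inter> V) x" for x
    by (rule orth_proj_comp_subset) (simp_all add: subspace_inter U V)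
  show ?thesis
    unfolding one_step_convergence_def
    by (metis eq orth_proj_id[OF V] orth_proj_in_orthogonal(1)[OF V])
qed

text \<open>Convergence makes every \<open>y\<close> in \<open>V \<inter> (U \<inter> V)\<^sup>\<bottom>\<close> a multiple of \<open>M y\<close>, hence an eigenvector
  of \<open>M\<close> with nonzero eigenvalue; all these eigenvalues coincide, and \<open>M\<close> is positive semidefinite.\<close>

lemma one_step_convergence_iff_M_scalar:
  assumes U: "subspace U" and V: "subspace V" and VU: "\<not> V \<subseteq> U"
  shows "one_step_convergence U V \<longleftrightarrow> M_scalar U V"
proof
  assume conv: "one_step_convergence U V"
  let ?W = "V \<inter> (U \<inter> V)\<^sup>\<bottom>"
  note UV = subspace_inter[OF U V]
  have mult: "\<exists>c. y = c *\<^sub>R M_op U V y" if y: "y \<in> ?W" for y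
  proof -
    have "orth_proj (U \<inter> V) y = 0"
      using y by (intro orth_proj_subspace_eqI[OF UV])
        (auto simp: subspace_0 U V orthogonal_comp_def orthogonal_def inner_commute)
    then show ?thesis
      using conv C_T_eq_proj_iff[OF U V, of y] y by (auto simp: one_step_convergence_iff[OF U V])
  qed
  have "\<exists>c. M_op U V y = c *\<^sub>R y" if y: "y \<in> ?W" for y
  proof (cases "y = 0")
    case False
    from mult[OF y] obtain c where c: "y = c *\<^sub>R M_op U V y" ..
    with False have "c \<noteq> 0" by auto
    then have "M_op U V y = (1 / c) *\<^sub>R (c *\<^sub>R M_op U V y)" by simp
    with c show ?thesis by metis
  qed (simp add: linear_0[OF linear_M_op[OF U V]])
  moreover have "subspace ?W" by (simp add: subspace_inter V subspace_orthogonal_comp)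
  ultimately obtain c where c: "\<forall>y\<in>?W. M_op U V y = c *\<^sub>R y"
    using all_eigenvectors_imp_scalar[OF linear_M_op[OF U V]] by blast
  obtain v where v: "v \<in> ?W" "v \<noteq> 0" using ortho_part_nonzero[OF assms] .
  have "c * inner v v \<ge> 0" using inner_M_op[OF U V, of v] v(1) c by simp
  with v(2) have "c \<ge> 0" by (metis inner_gt_zero_iff not_less zero_le_mult_iff)
  moreover have "c \<noteq> 0" using mult[OF v(1)] c v by auto
  ultimately have "c > 0" by simp
  with c show "M_scalar U V" unfolding M_scalar_def by blast
next
  assume "M_scalar U V"
  then obtain c where c: "c > 0" "\<And>v. v \<in> V \<inter> (U \<inter> V)\<^sup>\<bottom> \<Longrightarrow> M_op U V v = c *\<^sub>R v"
    by (auto simp: M_scalar_def)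
  show "one_step_convergence U V"
    unfolding one_step_convergence_iff[OF U V]
  proof
    fix x assume x: "x \<in> V"
    let ?w = "orth_proj (U \<inter> V) x"
    have w: "?w \<in> U \<inter> V" by (rule orth_proj_in_orthogonal(1)[OF subspace_inter[OF U V]])
    then have "M_op U V ?w = 0" by (simp add: M_op_def orth_proj_id U V)
    then have "M_op U V x = c *\<^sub>R (x - ?w)"
      using c(2)[OF ortho_part_memI[OF U V x]] by (simp add: linear_diff[OF linear_M_op[OF U V]])
    with c(1) have "x - ?w = (1 / c) *\<^sub>R M_op U V x" by simp
    then show "C_T U V x = ?w" using C_T_eq_proj_iff[OF U V x] by blast
  qed
qed

theorem corollary4p3:
  shows "(\<forall>U V :: (real ^ 'n) set. subspace U \<and> subspace V \<and> \<not> V \<subseteq> U \<longrightarrow>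
            (friedrichs_angle U V = principal_angle U V (dim V) \<longleftrightarrow> rho U V = 0) \<and>
            (rho U V = 0 \<longleftrightarrow> one_step_convergence U V) \<and>
            (one_step_convergence U V \<longleftrightarrow> M_scalar U V) \<and>
            (dim V - dim (U \<inter> V) = 1 \<longrightarrow>
               friedrichs_angle U V = principal_angle U V (dim V) \<and> rho U V = 0 \<and>
               one_step_convergence U V \<and> M_scalar U V)) \<and>
         (CARD('n) \<ge> 2 \<longrightarrow>
            (\<exists>U V :: (real ^ 'n) set. subspace U \<and> subspace V \<and> \<not> V \<subseteq> U \<and>
               friedrichs_angle U V = principal_angle U V (dim V) \<and> rho U V = 0 \<and>
               one_step_convergence U V \<and> M_scalar U V \<and>
               dim V - dim (U \<inter> V) \<noteq> 1))"
proof -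
  have equiv: "(friedrichs_angle U V = principal_angle U V (dim V) \<longleftrightarrow> rho U V = 0) \<and>
      (rho U V = 0 \<longleftrightarrow> one_step_convergence U V) \<and> (one_step_convergence U V \<longleftrightarrow> M_scalar U V)"
    if "subspace U" "subspace V" "\<not> V \<subseteq> U" for U V :: "(real ^ 'n) set"
    using angles_eq_iff_extreme_eq[OF that] rho_eq_0_iff_extreme_eq[OF that]
      extreme_eq_iff_M_scalar[OF that] one_step_convergence_iff_M_scalar[OF that] by blast
  \<comment> \<open>in codimension one both angles have the same index\<close>
  have codim1: "friedrichs_angle U V = principal_angle U V (dim V)"
    if "dim V - dim (U \<inter> V) = 1" for U V :: "(real ^ 'n) set"
  proof -
    from that have "dim (U \<inter> V) + 1 = dim V" by arith
    then show ?thesis by (simp add: friedrichs_angle_def)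
  qed
  \<comment> \<open>for \<open>U = {0}\<close> and \<open>V\<close> the whole space, \<open>M\<close> is the identity\<close>
  have example: "\<exists>U V :: (real ^ 'n) set. subspace U \<and> subspace V \<and> \<not> V \<subseteq> U \<and>
      M_scalar U V \<and> dim V - dim (U \<inter> V) \<noteq> 1" if "CARD('n) \<ge> 2"
  proof (intro exI conjI)
    have UV: "subspace {0 :: real ^ 'n}" "subspace (UNIV :: (real ^ 'n) set)" by auto
    then show "subspace {0 :: real ^ 'n}" "subspace (UNIV :: (real ^ 'n) set)" by auto
    show "dim (UNIV :: (real ^ 'n) set) - dim ({0 :: real ^ 'n} \<inter> UNIV) \<noteq> 1"
      using that by simp
    show "\<not> (UNIV :: (real ^ 'n) set) \<subseteq> {0}"
    proof
      assume "(UNIV :: (real ^ 'n) set) \<subseteq> {0}"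
      then have "axis undefined (1 :: real) = (0 :: real ^ 'n)" by blast
      then show False by simp
    qed
    have "M_op {0} UNIV v = 1 *\<^sub>R v" for v :: "real ^ 'n"
      using orth_proj_in_orthogonal(1)[OF UV(1), of v] UV(2) by (simp add: M_op_def orth_proj_id)
    then show "M_scalar {0 :: real ^ 'n} UNIV" unfolding M_scalar_def by (intro exI[of _ 1]) simp
  qed
  show ?thesis
    using equiv codim1 example by metis
qed

end
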